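(* For $\varepsilon\in\mathbb D\setminus\{0\}$ let $\ell_\varepsilon$ denote the Lempert function of the bidisk $\mathbb D^2$ with respect to the three poles $a_0=(0,0)$, $a_1=(\varepsilon,0)$, $a_2=(0,\varepsilon)$. All limits below are taken, for fixed $z$, as $\varepsilon\to0$. (1) There exists a constant $C>0$ such that for every $z=(z_1,z_2)\in\mathbb D^2$ with $z_1=0$ or $z_2=0$ or $z_1+z_2=0$, $$\limsup_{\varepsilon\to0}\ell_\varepsilon(z)\le 2\log|z|+C.$$ (2) For any $c_0>0$ there exists a constant $C=C(c_0)>0$ such that for any $z=(z_1,z_2)\in\mathbb D^2$ with $z_1\ne0$, $z_2\neq 0$ satisfying $c_0\le\left|\frac{z_1}{z_2}\right|\le c_0^{-1}$ and $c_0\le\left|1+\frac{z_1}{z_2}\right|$, $$\liminf_{\varepsilon\to0}\ell_\varepsilon(z)\ge\frac32\log|z|-C\qquad\text{and}\qquad\liminf_{\varepsilon\to0}\ell_\varepsilon(z)\le\frac32\log|z|+C.$$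
   Context: $\mathbb D$ is the open unit disc in $\mathbb C$. For $z=(z_1,z_2)\in\mathbb C^2$, $|z|:=\max(|z_1|,|z_2|)$, and $\log 0=-\infty$. For a domain $\Omega\subset\mathbb C^n$ and poles $a_0,\dots,a_N\in\Omega$, the (Coman) Lempert function is $$\ell_{a_0,\dots,a_N}(z):=\inf\Big\{\sum_{j=0}^N\log|\zeta_j| : \zeta_j\in\mathbb D,\ \varphi(0)=z,\ \varphi(\zeta_j)=a_j,\ j=0,\dots,N,\ \text{for some holomorphic }\varphi:\mathbb D\to\Omega\Big\}.$$ *)

theory Defs
  imports "HOL-Analysis.Analysis"
begin

text \<open>Logarithm with \<open>log 0 = - \<infinity>\<close>; the library has \<open>ln 0 = 0\<close> on the reals.
  It is only meant for nonnegative arguments.\<close>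

definition elog :: "real \<Rightarrow> ereal" where
  "elog x = (if x = 0 then - \<infinity> else ereal (ln x))"

definition unit_disc :: "complex set" where
  "unit_disc = ball 0 1"

definition bidisk :: "(complex ^ 2) set" where
  "bidisk = {z. z $ 1 \<in> unit_disc \<and> z $ 2 \<in> unit_disc}"

text \<open>This is neither \<open>norm\<close>, which is Euclidean on \<^typ>\<open>complex ^ 2\<close>, nor \<open>infnorm\<close>, which
  takes the maximum over real and imaginary parts.\<close>

definition max_norm :: "complex ^ 2 \<Rightarrow> real" where
  "max_norm z = max (cmod (z $ 1)) (cmod (z $ 2))"

text \<open>The library's \<open>holomorphic_on\<close> is for scalar functions, so it is applied coordinatewise.\<close>

definition holomorphic_disc :: "(complex \<Rightarrow> complex ^ 'n) \<Rightarrow> (complex ^ 'n) set \<Rightarrow> bool" where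
  "holomorphic_disc \<phi> \<Omega> \<longleftrightarrow>
     (\<forall>i. (\<lambda>\<zeta>. \<phi> \<zeta> $ i) holomorphic_on unit_disc) \<and> \<phi> ` unit_disc \<subseteq> \<Omega>"

text \<open>The poles \<open>a\<^sub>0, \<dots>, a\<^sub>N\<close> are given as a list of length \<open>N + 1\<close>.  The summands lie in
  \<open>[- \<infinity>, 0)\<close>, so the sum involves no \<open>\<infinity> - \<infinity>\<close>.\<close>

definition lempert :: "(complex ^ 'n) set \<Rightarrow> (complex ^ 'n) list \<Rightarrow> complex ^ 'n \<Rightarrow> ereal" where
  "lempert \<Omega> as z =
     Inf {\<Sum>j<length as. elog (cmod (\<zeta> j)) | \<zeta> :: nat \<Rightarrow> complex.
            (\<forall>j<length as. \<zeta> j \<in> unit_disc) \<and>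
            (\<exists>\<phi>. holomorphic_disc \<phi> \<Omega> \<and> \<phi> 0 = z \<and> (\<forall>j<length as. \<phi> (\<zeta> j) = as ! j))}"

definition lempert_eps :: "complex \<Rightarrow> complex ^ 2 \<Rightarrow> ereal" where
  "lempert_eps \<epsilon> = lempert bidisk [vector [0, 0], vector [\<epsilon>, 0], vector [0, \<epsilon>]]"

end

theory Submission
  imports Defs "HOL-Complex_Analysis.Riemann_Mapping"
begin

text \<open>
  A competitor for \<open>\<ell>\<^sub>\<epsilon>(z)\<close> is a disc \<open>\<phi> = (f, g)\<close> with \<open>\<phi> 0 = z\<close> that meets \<open>(0, 0)\<close>, \<open>(\<epsilon>, 0)\<close> and
  \<open>(0, \<epsilon>)\<close> at parameters \<open>a\<close>, \<open>b\<close>, \<open>c\<close>, and the functional to minimise is the logarithm of \<open>\<bar>a b c\<bar>\<close>.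
  Up to constants, both parts are therefore estimates of \<open>\<bar>a b c\<bar>\<close> by \<open>\<bar>z\<bar>\<^sup>2\<close> or by
  \<open>\<bar>z\<bar> powr (3/2)\<close>.

  \<^bold>\<open>Lower bound.\<close> The three lines through two of the poles are the zero sets of \<open>z\<^sub>1\<close>, \<open>z\<^sub>2\<close> and
  \<open>z\<^sub>1 + z\<^sub>2 - \<epsilon>\<close>. Accordingly \<open>f\<close> vanishes at \<open>a, c\<close>, \<open>g\<close> at \<open>a, b\<close>, and \<open>f + g - \<epsilon>\<close> at \<open>b, c\<close>. The
  Schwarz lemma with two zeros bounds the value at \<open>0\<close> by the product of the two zeros
  (\<open>disc_through_lower_bounds\<close>), so that \<open>\<bar>a c\<bar>\<close>, \<open>\<bar>a b\<bar>\<close> and \<open>\<bar>b c\<bar>\<close> are all at least a constant times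
  \<open>\<bar>z\<bar>\<close> when \<open>z\<close> satisfies the ratio conditions and \<open>\<epsilon>\<close> is small. Their product is \<open>\<bar>a b c\<bar>\<^sup>2\<close>,
  which gives the exponent \<open>3/2\<close>.

  \<^bold>\<open>Upper bounds.\<close> For \<open>\<bar>z\<bar> \<ge> 1/32\<close> only the existence of a disc is at stake, and a combination of
  Blaschke products provides one for small \<open>\<epsilon>\<close> (\<open>eventually_disc_through\<close>). For \<open>0 < \<bar>z\<bar> < 1/32\<close> the
  coordinates are cubic polynomials with prescribed zeros, and the parameters depend on \<open>\<epsilon>\<close>. If two
  of them merge as \<open>\<epsilon> \<longrightarrow> 0\<close>, the limit disc passes through the origin in the direction of the line
  through the two poles; if all three merge, it vanishes there to second order.
  \<^item> If \<open>z\<close> lies on one of the three limit lines \<open>z\<^sub>1 = 0\<close>, \<open>z\<^sub>2 = 0\<close>, \<open>z\<^sub>1 + z\<^sub>2 = 0\<close>,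
    the parameters of one pair of poles merge at a point of size \<open>\<bar>z\<bar>\<close> and the third parameter
    is \<open>1/2\<close>. The product is then of order \<open>\<bar>z\<bar>\<^sup>2\<close>.
  \<^item> If \<open>z\<close> lies on none of these lines, all three parameters merge at a point \<open>s\<close> of size
    \<open>\<bar>z\<bar> powr (1/2)\<close>, and the limit disc is \<open>\<zeta> \<mapsto> (1 - \<zeta> / s)\<^sup>2 z\<close>. The product is then of order
    \<open>\<bar>z\<bar> powr (3/2)\<close>.
\<close>

section \<open>Discs through the three poles\<close>

definition disc_through ::
    "complex \<Rightarrow> complex \<Rightarrow> complex \<Rightarrow> complex \<Rightarrow> complex \<Rightarrow> complex \<Rightarrow> bool" where
  "disc_through \<epsilon> x y a b c \<longleftrightarrow>
     cmod a < 1 \<and> cmod b < 1 \<and> cmod c < 1 \<and>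
     (\<exists>f g. f holomorphic_on ball 0 1 \<and> g holomorphic_on ball 0 1 \<and>
        (\<forall>\<zeta>. cmod \<zeta> < 1 \<longrightarrow> cmod (f \<zeta>) < 1 \<and> cmod (g \<zeta>) < 1) \<and>
        f 0 = x \<and> g 0 = y \<and> f a = 0 \<and> g a = 0 \<and> f b = \<epsilon> \<and> g b = 0 \<and> f c = 0 \<and> g c = \<epsilon>)"

lemma disc_throughI:
  assumes "cmod a < 1" "cmod b < 1" "cmod c < 1"
    and "f holomorphic_on ball 0 1" "g holomorphic_on ball 0 1"
    and "\<And>\<zeta>. cmod \<zeta> < 1 \<Longrightarrow> cmod (f \<zeta>) < 1" "\<And>\<zeta>. cmod \<zeta> < 1 \<Longrightarrow> cmod (g \<zeta>) < 1"
    and "f 0 = x" "g 0 = y" "f a = 0" "g a = 0" "f b = \<epsilon>" "g b = 0" "f c = 0" "g c = \<epsilon>"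
  shows "disc_through \<epsilon> x y a b c"
  unfolding disc_through_def using assms by blast

text \<open>Exchanging the coordinates exchanges the last two poles.\<close>

lemma disc_through_swap: "disc_through \<epsilon> x y a b c \<Longrightarrow> disc_through \<epsilon> y x a c b"
  unfolding disc_through_def by blast

lemma elog_mult: "elog (x * y) = elog x + elog y" if "0 \<le> x" "0 \<le> y"
  using that by (auto simp: elog_def ln_mult)

lemma elog_mono: "elog x \<le> elog y" if "0 \<le> x" "x \<le> y"
  using that by (auto simp: elog_def)

lemma elog_powr: "ereal t * elog x + ereal C = elog (exp C * x powr t)" if "0 < t" "0 \<le> x"
  using that by (auto simp: elog_def ln_mult ln_powr)

text \<open>Splitting the disc into its two coordinates, and the sum of the three logarithms into the
  logarithm of the product, turns all later estimates into estimates of \<open>cmod (a * b * c)\<close>.\<close>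

lemma lempert_eps_eq:
  "lempert_eps \<epsilon> z = Inf {elog (cmod (a * b * c)) | a b c. disc_through \<epsilon> (z $ 1) (z $ 2) a b c}"
proof -
  let ?as = "[vector [0, 0], vector [\<epsilon>, 0], vector [0, \<epsilon>]] :: (complex ^ 2) list"
  have all3: "(\<forall>j<length ?as. P j) \<longleftrightarrow> P 0 \<and> P 1 \<and> P 2" for P :: "nat \<Rightarrow> bool"
    by (auto simp: less_Suc_eq numeral_2_eq_2)
  have sum3: "(\<Sum>j<length ?as. elog (cmod (\<zeta> j))) = elog (cmod (\<zeta> 0 * \<zeta> 1 * \<zeta> 2))"
    for \<zeta> :: "nat \<Rightarrow> complex"
    by (simp add: norm_mult elog_mult numeral_2_eq_2)
  have disc: "(\<forall>j<length ?as. \<zeta> j \<in> unit_disc) \<and>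
       (\<exists>\<phi>. holomorphic_disc \<phi> bidisk \<and> \<phi> 0 = z \<and> (\<forall>j<length ?as. \<phi> (\<zeta> j) = ?as ! j))
     \<longleftrightarrow> disc_through \<epsilon> (z $ 1) (z $ 2) (\<zeta> 0) (\<zeta> 1) (\<zeta> 2)" (is "?L \<longleftrightarrow> ?R")
    for \<zeta> :: "nat \<Rightarrow> complex"
  proof
    assume ?L
    then obtain \<phi> where \<phi>: "holomorphic_disc \<phi> bidisk" "\<phi> 0 = z"
      "\<phi> (\<zeta> 0) = vector [0, 0]" "\<phi> (\<zeta> 1) = vector [\<epsilon>, 0]" "\<phi> (\<zeta> 2) = vector [0, \<epsilon>]"
      and \<zeta>: "\<zeta> 0 \<in> unit_disc" "\<zeta> 1 \<in> unit_disc" "\<zeta> 2 \<in> unit_disc"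
      unfolding all3 by auto
    show ?R
      by (rule disc_throughI[where f = "\<lambda>\<zeta>. \<phi> \<zeta> $ 1" and g = "\<lambda>\<zeta>. \<phi> \<zeta> $ 2"])
        (use \<phi> \<zeta> in \<open>auto simp: holomorphic_disc_def bidisk_def unit_disc_def image_subset_iff\<close>)
  next
    assume ?R
    then obtain f g where fg: "f holomorphic_on ball 0 1" "g holomorphic_on ball 0 1"
      "\<And>w. cmod w < 1 \<Longrightarrow> cmod (f w) < 1" "\<And>w. cmod w < 1 \<Longrightarrow> cmod (g w) < 1"
      "f 0 = z $ 1" "g 0 = z $ 2" "f (\<zeta> 0) = 0" "g (\<zeta> 0) = 0" "f (\<zeta> 1) = \<epsilon>" "g (\<zeta> 1) = 0"
      "f (\<zeta> 2) = 0" "g (\<zeta> 2) = \<epsilon>"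
      and \<zeta>: "\<zeta> 0 \<in> unit_disc" "\<zeta> 1 \<in> unit_disc" "\<zeta> 2 \<in> unit_disc"
      unfolding disc_through_def by (auto simp: unit_disc_def)
    define \<phi> :: "complex \<Rightarrow> complex ^ 2" where "\<phi> = (\<lambda>w. vector [f w, g w])"
    have "holomorphic_disc \<phi> bidisk"
      using fg by (auto simp: \<phi>_def holomorphic_disc_def bidisk_def unit_disc_def forall_2)
    moreover have "\<phi> 0 = z"
      using fg by (simp add: \<phi>_def vec_eq_iff forall_2)
    moreover have "\<phi> (\<zeta> 0) = vector [0, 0]" "\<phi> (\<zeta> 1) = vector [\<epsilon>, 0]" "\<phi> (\<zeta> 2) = vector [0, \<epsilon>]"
      using fg by (simp_all add: \<phi>_def)
    ultimately show ?L
      unfolding all3 using \<zeta> by auto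
  qed
  have "{\<Sum>j<length ?as. elog (cmod (\<zeta> j)) | \<zeta>. (\<forall>j<length ?as. \<zeta> j \<in> unit_disc) \<and>
       (\<exists>\<phi>. holomorphic_disc \<phi> bidisk \<and> \<phi> 0 = z \<and> (\<forall>j<length ?as. \<phi> (\<zeta> j) = ?as ! j))}
     = {elog (cmod (\<zeta> 0 * \<zeta> 1 * \<zeta> 2)) | \<zeta> :: nat \<Rightarrow> complex.
          disc_through \<epsilon> (z $ 1) (z $ 2) (\<zeta> 0) (\<zeta> 1) (\<zeta> 2)}"
    unfolding disc sum3 ..
  also have "\<dots> = {elog (cmod (a * b * c)) | a b c. disc_through \<epsilon> (z $ 1) (z $ 2) a b c}"
  proof (intro equalityI subsetI)
    fix r assume "r \<in> {elog (cmod (a * b * c)) | a b c. disc_through \<epsilon> (z $ 1) (z $ 2) a b c}"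
    then obtain a b c where "r = elog (cmod (a * b * c))" "disc_through \<epsilon> (z $ 1) (z $ 2) a b c"
      by blast
    then show "r \<in> {elog (cmod (\<zeta> 0 * \<zeta> 1 * \<zeta> 2)) | \<zeta> :: nat \<Rightarrow> complex.
          disc_through \<epsilon> (z $ 1) (z $ 2) (\<zeta> 0) (\<zeta> 1) (\<zeta> 2)}"
      by (intro CollectI exI[of _ "\<lambda>j. if j = 0 then a else if j = 1 then b else c"]) simp
  qed blast
  finally show ?thesis
    unfolding lempert_eps_def lempert_def by simp
qed

lemma lempert_eps_le:
  assumes "disc_through \<epsilon> (z $ 1) (z $ 2) a b c" "cmod (a * b * c) \<le> m"
  shows "lempert_eps \<epsilon> z \<le> elog m"
proof -
  have "lempert_eps \<epsilon> z \<le> elog (cmod (a * b * c))"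
    unfolding lempert_eps_eq using assms(1) by (blast intro: Inf_lower)
  also have "\<dots> \<le> elog m"
    using assms(2) by (intro elog_mono) auto
  finally show ?thesis .
qed

lemma lempert_eps_ge:
  assumes "0 \<le> m" "\<And>a b c. disc_through \<epsilon> (z $ 1) (z $ 2) a b c \<Longrightarrow> m \<le> cmod (a * b * c)"
  shows "elog m \<le> lempert_eps \<epsilon> z"
  unfolding lempert_eps_eq using assms by (auto intro!: Inf_greatest elog_mono)

section \<open>Schwarz bounds\<close>

text \<open>Precomposing with the disc automorphism that sends \<open>0\<close> to \<open>a\<close> reduces this to the Schwarz
  lemma. The latter asks for a strict bound, whence the detour through all \<open>N > M\<close>.\<close>

lemma Schwarz_Pick_zero:
  assumes holf: "f holomorphic_on ball 0 1" and M: "\<And>\<zeta>. cmod \<zeta> < 1 \<Longrightarrow> cmod (f \<zeta>) \<le> M"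
    and a: "cmod a < 1" "f a = 0" and z: "cmod z < 1"
  shows "cmod (f z) \<le> M * cmod (Moebius_function 0 a z)"
proof -
  have strict: "cmod (f z) \<le> N * cmod (Moebius_function 0 a z)" if "M < N" for N
  proof -
    have "0 \<le> M" using M[of 0] by (smt (verit) norm_ge_zero norm_zero)
    then have "0 < N" using that by simp
    define h where "h = (\<lambda>w. f (Moebius_function 0 (- a) w) / of_real N)"
    have "(f \<circ> Moebius_function 0 (- a)) holomorphic_on ball 0 1"
      by (rule holomorphic_on_compose_gen[OF Moebius_function_holomorphic holf])
        (use a in \<open>auto intro!: Moebius_function_norm_lt_1\<close>)
    then have "h holomorphic_on ball 0 1"
      unfolding h_def using \<open>0 < N\<close> by (auto intro!: holomorphic_intros simp: o_def)
    moreover have "h 0 = 0"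
      using a by (simp add: h_def Moebius_function_of_zero)
    moreover have "cmod (h w) < 1" if "cmod w < 1" for w
      using M[of "Moebius_function 0 (- a) w"] a that \<open>M < N\<close> \<open>0 < N\<close>
      by (simp add: h_def norm_divide Moebius_function_norm_lt_1)
    moreover have "cmod (Moebius_function 0 a z) < 1"
      using a z by (simp add: Moebius_function_norm_lt_1)
    ultimately have "cmod (h (Moebius_function 0 a z)) \<le> cmod (Moebius_function 0 a z)"
      by (rule Schwarz_Lemma(1))
    moreover have "Moebius_function 0 (- a) (Moebius_function 0 a z) = z"
      using a z by (intro Moebius_function_compose) auto
    ultimately show ?thesis
      using \<open>0 < N\<close> by (simp add: h_def norm_divide field_simps)
  qed
  have "((\<lambda>N. N * cmod (Moebius_function 0 a z)) \<longlongrightarrow> M * cmod (Moebius_function 0 a z)) (at_right M)"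
    by (intro tendsto_intros)
  then show ?thesis
    by (rule tendsto_lowerbound)
      (auto simp: eventually_at_right_field intro!: strict exI[of _ "M + 1"])
qed

text \<open>Dividing \<open>f\<close> by the Blaschke factor of its zero \<open>a\<close> does not increase the bound \<open>M\<close>, by the
  one-zero estimate; the quotient still vanishes at \<open>b\<close>, and the estimate applies once more.\<close>

lemma Schwarz_two_zeros:
  assumes holf: "f holomorphic_on ball 0 1" and M: "\<And>\<zeta>. cmod \<zeta> < 1 \<Longrightarrow> cmod (f \<zeta>) \<le> M"
    and a: "cmod a < 1" "f a = 0" and b: "cmod b < 1" "f b = 0" and "a \<noteq> b"
  shows "cmod (f 0) \<le> M * cmod (a * b)"
proof -
  \<comment> \<open>\<open>k\<close> is the quotient by the Blaschke factor, with the removable singularity at \<open>a\<close> filled in.\<close>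
  define g where "g = (\<lambda>z. if z = a then deriv f a else f z / (z - a))"
  have holg: "g holomorphic_on ball 0 1"
    by (rule pole_theorem_open_0[OF holf, of a]) (use a in \<open>auto simp: g_def\<close>)
  define k where "k = (\<lambda>z. g z * (1 - cnj a * z))"
  have holk: "k holomorphic_on ball 0 1"
    unfolding k_def by (intro holomorphic_intros holg)
  have nz: "1 - cnj a * z \<noteq> 0" if "cmod z < 1" for z
  proof
    assume "1 - cnj a * z = 0"
    then have "cmod (cnj a * z) = 1" by simp
    moreover have "cmod a * cmod z \<le> 1 * cmod z"
      using a by (intro mult_right_mono) auto
    ultimately show False using that by (simp add: norm_mult)
  qed
  have off: "cmod (k z) \<le> M" if "cmod z < 1" "z \<noteq> a" for z
    using Schwarz_Pick_zero[OF holf M a that(1)] that nz[OF that(1)]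
    by (simp add: k_def g_def Moebius_function_simple norm_mult norm_divide divide_simps mult.commute)
  have "cmod (k a) \<le> M"
  proof (rule Lim_norm_ubound[where net = "at a"])
    have "isCont k a"
      using holk a by (intro continuous_on_interior[OF holomorphic_on_imp_continuous_on[OF holk]]) auto
    then show "(k \<longlongrightarrow> k a) (at a)" by (simp add: isCont_def)
    have "\<forall>\<^sub>F z in at a. z \<in> ball 0 1"
      using a by (intro eventually_at_in_open') auto
    moreover have "\<forall>\<^sub>F z in at a. z \<noteq> a"
      by (rule eventually_neq_at_within)
    ultimately show "\<forall>\<^sub>F z in at a. cmod (k z) \<le> M"
      by eventually_elim (use off in auto)
  qed simp
  then have kM: "cmod (k z) \<le> M" if "cmod z < 1" for z
    using off that by (cases "z = a") auto
  have "k b = 0"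
    using b \<open>a \<noteq> b\<close> by (simp add: k_def g_def)
  from Schwarz_Pick_zero[OF holk kM b(1) this, of 0]
  have k0: "cmod (k 0) \<le> M * cmod b"
    by (simp add: Moebius_function_simple)
  have "f 0 = - a * k 0"
    using a by (auto simp: k_def g_def)
  then show ?thesis
    using mult_left_mono[OF k0, of "cmod a"] by (simp add: norm_mult mult_ac)
qed

section \<open>Lower bound\<close>

text \<open>Each bound comes from one of the three lines through two of the poles: its defining function
  pulls back to a bounded function with two zeros in the disc.\<close>

lemma disc_through_lower_bounds:
  assumes disc: "disc_through \<epsilon> x y a b c" and "\<epsilon> \<noteq> 0" "cmod \<epsilon> \<le> 1"
  shows "cmod x \<le> cmod (a * c)" "cmod y \<le> cmod (a * b)" "cmod (x + y - \<epsilon>) \<le> 3 * cmod (b * c)"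
proof -
  obtain f g where abc: "cmod a < 1" "cmod b < 1" "cmod c < 1"
    and hol: "f holomorphic_on ball 0 1" "g holomorphic_on ball 0 1"
    and bd: "\<And>w. cmod w < 1 \<Longrightarrow> cmod (f w) < 1" "\<And>w. cmod w < 1 \<Longrightarrow> cmod (g w) < 1"
    and val: "f 0 = x" "g 0 = y" "f a = 0" "g a = 0" "f b = \<epsilon>" "g b = 0" "f c = 0" "g c = \<epsilon>"
    using disc unfolding disc_through_def by blast
  have ne: "a \<noteq> c" "a \<noteq> b" "b \<noteq> c"
    using val \<open>\<epsilon> \<noteq> 0\<close> by auto
  show "cmod x \<le> cmod (a * c)"
    using Schwarz_two_zeros[OF hol(1), of 1 a c] bd(1) abc val ne by (simp add: less_imp_le)
  show "cmod y \<le> cmod (a * b)"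
    using Schwarz_two_zeros[OF hol(2), of 1 a b] bd(2) abc val ne by (simp add: less_imp_le)
  have "cmod (f w + g w - \<epsilon>) \<le> 3" if "cmod w < 1" for w
    using bd(1)[OF that] bd(2)[OF that] norm_triangle_ineq[of "f w" "g w"]
      norm_triangle_ineq4[of "f w + g w" \<epsilon>] \<open>cmod \<epsilon> \<le> 1\<close> by linarith
  moreover have "(\<lambda>w. f w + g w - \<epsilon>) holomorphic_on ball 0 1"
    by (intro holomorphic_intros hol)
  ultimately show "cmod (x + y - \<epsilon>) \<le> 3 * cmod (b * c)"
    using Schwarz_two_zeros[of "\<lambda>w. f w + g w - \<epsilon>" 3 b c] abc val ne by simp
qed

text \<open>The three pairwise products multiply to the square of \<open>cmod (a * b * c)\<close>.\<close>

lemma disc_through_product_ge: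
  assumes disc: "disc_through \<epsilon> x y a b c" and "\<epsilon> \<noteq> 0" "cmod \<epsilon> \<le> 1" and "0 < k" "0 \<le> r"
    and x: "k * r \<le> cmod x" and y: "k * r \<le> cmod y"
    and xy: "k\<^sup>2 * r \<le> cmod (x + y)" and \<epsilon>: "cmod \<epsilon> \<le> k\<^sup>2 * r / 2"
  shows "k\<^sup>2 / 3 * r powr (3 / 2) \<le> cmod (a * b * c)"
proof -
  note low = disc_through_lower_bounds[OF disc \<open>\<epsilon> \<noteq> 0\<close> \<open>cmod \<epsilon> \<le> 1\<close>]
  have ac: "k * r \<le> cmod (a * c)" and ab: "k * r \<le> cmod (a * b)"
    using low x y by linarith+
  have bc: "k\<^sup>2 * r / 6 \<le> cmod (b * c)"
    using low(3) xy \<epsilon> norm_triangle_ineq2[of "x + y" \<epsilon>] by linarith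
  have "(r powr (3 / 2))\<^sup>2 = r ^ 3"
    using \<open>0 \<le> r\<close> by (simp add: power2_eq_square flip: powr_add)
  then have "(k\<^sup>2 / 3 * r powr (3 / 2))\<^sup>2 = k ^ 4 * r ^ 3 / 9"
    by (simp add: power_mult_distrib power_divide)
  also have "\<dots> \<le> (k * r) * (k * r) * (k\<^sup>2 * r / 6)"
    using \<open>0 < k\<close> \<open>0 \<le> r\<close> by (simp add: power2_eq_square power3_eq_cube power4_eq_xxxx)
  also have "\<dots> \<le> cmod (a * c) * cmod (a * b) * cmod (b * c)"
    using \<open>0 < k\<close> \<open>0 \<le> r\<close> by (intro mult_mono ac ab bc) auto
  also have "\<dots> = (cmod (a * b * c))\<^sup>2"
    by (simp add: norm_mult power2_eq_square mult_ac)
  finally show ?thesis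
    by (rule power2_le_imp_le) simp
qed

section \<open>Upper bounds\<close>

lemma norm_affine_le:
  fixes u v z :: complex
  assumes "cmod z \<le> 1"
  shows "cmod (u + v * z) \<le> cmod u + cmod v"
  using norm_triangle_ineq[of u "v * z"] mult_left_mono[OF assms, of "cmod v"]
  by (simp add: norm_mult)

text \<open>The polynomial is \<open>(\<zeta> - p) * (\<zeta> - q) * (u + v * \<zeta>)\<close>, whose last factor is the linear interpolant
  of the values that it must take at \<open>0\<close> and \<open>w\<close>. Its slope is small when these two values are close,
  which is what the choices of parameters below arrange.\<close>

lemma cubic_interpolation:
  assumes "p \<noteq> 0" "q \<noteq> 0" "w \<noteq> 0" "w \<noteq> p" "w \<noteq> q"
    and small: "(1 + cmod p) * (1 + cmod q) *
        (cmod (x / (p * q)) + cmod (\<epsilon> / ((w - p) * (w - q)) - x / (p * q)) / cmod w) < 1"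
  obtains f where "f holomorphic_on ball 0 1" "\<And>\<zeta>. cmod \<zeta> < 1 \<Longrightarrow> cmod (f \<zeta>) < 1"
    "f 0 = x" "f p = 0" "f q = 0" "f w = \<epsilon>"
proof
  let ?u = "x / (p * q)" and ?v = "(\<epsilon> / ((w - p) * (w - q)) - x / (p * q)) / w"
  let ?f = "\<lambda>\<zeta>. (\<zeta> - p) * (\<zeta> - q) * (?u + ?v * \<zeta>)"
  show "?f holomorphic_on ball 0 1"
    by (intro holomorphic_intros) (use assms in auto)
  show "cmod (?f \<zeta>) < 1" if "cmod \<zeta> < 1" for \<zeta>
  proof -
    have "cmod (\<zeta> - p) \<le> 1 + cmod p" "cmod (\<zeta> - q) \<le> 1 + cmod q"
      using that norm_triangle_ineq4[of \<zeta> p] norm_triangle_ineq4[of \<zeta> q] by linarith+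
    moreover have "cmod (?u + ?v * \<zeta>) \<le> cmod ?u + cmod ?v"
      by (rule norm_affine_le) (use that in simp)
    ultimately have "cmod (?f \<zeta>) \<le> (1 + cmod p) * (1 + cmod q) * (cmod ?u + cmod ?v)"
      unfolding norm_mult by (intro mult_mono) auto
    then show ?thesis
      using small by (simp add: norm_divide)
  qed
  show "?f 0 = x" "?f p = 0" "?f q = 0" "?f w = \<epsilon>"
    using assms by simp_all
qed

lemma disc_through_cubic:
  assumes "cmod a < 1" "cmod b < 1" "cmod c < 1"
    and ne: "a \<noteq> 0" "b \<noteq> 0" "c \<noteq> 0" "a \<noteq> b" "a \<noteq> c" "b \<noteq> c"
    and "(1 + cmod a) * (1 + cmod c) *
        (cmod (x / (a * c)) + cmod (\<epsilon> / ((b - a) * (b - c)) - x / (a * c)) / cmod b) < 1"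
    and "(1 + cmod a) * (1 + cmod b) *
        (cmod (y / (a * b)) + cmod (\<epsilon> / ((c - a) * (c - b)) - y / (a * b)) / cmod c) < 1"
  shows "disc_through \<epsilon> x y a b c"
proof -
  obtain f where "f holomorphic_on ball 0 1" "\<And>\<zeta>. cmod \<zeta> < 1 \<Longrightarrow> cmod (f \<zeta>) < 1"
    "f 0 = x" "f a = 0" "f c = 0" "f b = \<epsilon>"
    by (rule cubic_interpolation[of a c b x \<epsilon>]) (use assms in auto)
  moreover obtain g where "g holomorphic_on ball 0 1" "\<And>\<zeta>. cmod \<zeta> < 1 \<Longrightarrow> cmod (g \<zeta>) < 1"
    "g 0 = y" "g a = 0" "g b = 0" "g c = \<epsilon>"
    by (rule cubic_interpolation[of a b c y \<epsilon>]) (use assms in auto)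
  ultimately show ?thesis
    using assms(1-3) by (intro disc_throughI)
qed

text \<open>In the limit the linear factors above become constants, because \<open>limx\<close> and \<open>limy\<close> match the
  value needed at the pole with the value needed at \<open>0\<close>. The remaining conditions, apart from
  \<open>distinct\<close>, are open and only concern the limits of the parameters. These limits may coincide; \<open>limx\<close> and \<open>limy\<close> then prescribe
  how fast the parameters separate.\<close>

lemma eventually_disc_through_cubic:
  assumes lim: "(a \<longlongrightarrow> a\<^sub>0) (at 0)" "(b \<longlongrightarrow> b\<^sub>0) (at 0)" "(c \<longlongrightarrow> c\<^sub>0) (at 0)"
    and lt1: "cmod a\<^sub>0 < 1" "cmod b\<^sub>0 < 1" "cmod c\<^sub>0 < 1" and ne0: "a\<^sub>0 \<noteq> 0" "b\<^sub>0 \<noteq> 0" "c\<^sub>0 \<noteq> 0"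
    and distinct: "\<forall>\<^sub>F \<epsilon> in at 0. a \<epsilon> \<noteq> b \<epsilon> \<and> a \<epsilon> \<noteq> c \<epsilon> \<and> b \<epsilon> \<noteq> c \<epsilon>"
    and limx: "((\<lambda>\<epsilon>. \<epsilon> / ((b \<epsilon> - a \<epsilon>) * (b \<epsilon> - c \<epsilon>))) \<longlongrightarrow> x / (a\<^sub>0 * c\<^sub>0)) (at 0)"
    and limy: "((\<lambda>\<epsilon>. \<epsilon> / ((c \<epsilon> - a \<epsilon>) * (c \<epsilon> - b \<epsilon>))) \<longlongrightarrow> y / (a\<^sub>0 * b\<^sub>0)) (at 0)"
    and smallx: "(1 + cmod a\<^sub>0) * (1 + cmod c\<^sub>0) * cmod (x / (a\<^sub>0 * c\<^sub>0)) < 1"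
    and smally: "(1 + cmod a\<^sub>0) * (1 + cmod b\<^sub>0) * cmod (y / (a\<^sub>0 * b\<^sub>0)) < 1"
    and m: "cmod (a\<^sub>0 * b\<^sub>0 * c\<^sub>0) < m"
  shows "\<forall>\<^sub>F \<epsilon> in at 0. \<exists>a b c. disc_through \<epsilon> x y a b c \<and> cmod (a * b * c) \<le> m"
proof -
  have "((\<lambda>\<epsilon>. (1 + cmod (a \<epsilon>)) * (1 + cmod (c \<epsilon>)) * (cmod (x / (a \<epsilon> * c \<epsilon>)) +
         cmod (\<epsilon> / ((b \<epsilon> - a \<epsilon>) * (b \<epsilon> - c \<epsilon>)) - x / (a \<epsilon> * c \<epsilon>)) / cmod (b \<epsilon>)))
     \<longlongrightarrow> (1 + cmod a\<^sub>0) * (1 + cmod c\<^sub>0) * (cmod (x / (a\<^sub>0 * c\<^sub>0)) +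
         cmod (x / (a\<^sub>0 * c\<^sub>0) - x / (a\<^sub>0 * c\<^sub>0)) / cmod b\<^sub>0)) (at 0)"
    by (intro tendsto_intros lim limx) (use ne0 in auto)
  then have 1: "\<forall>\<^sub>F \<epsilon> in at 0. (1 + cmod (a \<epsilon>)) * (1 + cmod (c \<epsilon>)) * (cmod (x / (a \<epsilon> * c \<epsilon>)) +
         cmod (\<epsilon> / ((b \<epsilon> - a \<epsilon>) * (b \<epsilon> - c \<epsilon>)) - x / (a \<epsilon> * c \<epsilon>)) / cmod (b \<epsilon>)) < 1"
    by (rule order_tendstoD) (use smallx in simp)
  have "((\<lambda>\<epsilon>. (1 + cmod (a \<epsilon>)) * (1 + cmod (b \<epsilon>)) * (cmod (y / (a \<epsilon> * b \<epsilon>)) +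
         cmod (\<epsilon> / ((c \<epsilon> - a \<epsilon>) * (c \<epsilon> - b \<epsilon>)) - y / (a \<epsilon> * b \<epsilon>)) / cmod (c \<epsilon>)))
     \<longlongrightarrow> (1 + cmod a\<^sub>0) * (1 + cmod b\<^sub>0) * (cmod (y / (a\<^sub>0 * b\<^sub>0)) +
         cmod (y / (a\<^sub>0 * b\<^sub>0) - y / (a\<^sub>0 * b\<^sub>0)) / cmod c\<^sub>0)) (at 0)"
    by (intro tendsto_intros lim limy) (use ne0 in auto)
  then have 2: "\<forall>\<^sub>F \<epsilon> in at 0. (1 + cmod (a \<epsilon>)) * (1 + cmod (b \<epsilon>)) * (cmod (y / (a \<epsilon> * b \<epsilon>)) +
         cmod (\<epsilon> / ((c \<epsilon> - a \<epsilon>) * (c \<epsilon> - b \<epsilon>)) - y / (a \<epsilon> * b \<epsilon>)) / cmod (c \<epsilon>)) < 1"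
    by (rule order_tendstoD) (use smally in simp)
  have 3: "\<forall>\<^sub>F \<epsilon> in at 0. cmod (a \<epsilon> * b \<epsilon> * c \<epsilon>) < m"
    by (rule order_tendstoD[OF _ m]) (intro tendsto_intros lim)
  have 4: "\<forall>\<^sub>F \<epsilon> in at 0. cmod (a \<epsilon>) < 1" "\<forall>\<^sub>F \<epsilon> in at 0. cmod (b \<epsilon>) < 1"
    "\<forall>\<^sub>F \<epsilon> in at 0. cmod (c \<epsilon>) < 1"
    by (rule order_tendstoD[OF tendsto_norm]; fact)+
  have 5: "\<forall>\<^sub>F \<epsilon> in at 0. a \<epsilon> \<noteq> 0" "\<forall>\<^sub>F \<epsilon> in at 0. b \<epsilon> \<noteq> 0" "\<forall>\<^sub>F \<epsilon> in at 0. c \<epsilon> \<noteq> 0"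
    by (rule tendsto_imp_eventually_ne; fact)+
  from 1 2 3 4 5 distinct show ?thesis
  proof eventually_elim
    case (elim \<epsilon>)
    then have "disc_through \<epsilon> x y (a \<epsilon>) (b \<epsilon>) (c \<epsilon>)"
      by (intro disc_through_cubic) auto
    with elim show ?case by (intro exI) auto
  qed
qed

text \<open>The parameters of \<open>(0, 0)\<close> and \<open>(0, \<epsilon>)\<close> merge at \<open>8 * y\<close>, and the one of \<open>(\<epsilon>, 0)\<close> is \<open>1 / 2\<close>. The
  limit of \<open>g\<close> is \<open>\<zeta> \<mapsto> (\<zeta> - 8 * y) * (\<zeta> - 1 / 2) / 4\<close>, while \<open>f\<close> tends to \<open>0\<close>.\<close>

lemma upper_bound_axis:
  assumes "y \<noteq> 0" "cmod y < 1 / 32"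
  shows "\<forall>\<^sub>F \<epsilon> in at 0. \<exists>a b c. disc_through \<epsilon> 0 y a b c \<and>
           cmod (a * b * c) \<le> 1024 * (cmod y)\<^sup>2"
proof -
  \<comment> \<open>\<open>k\<close> is the rate of separation for which \<open>g\<close> takes the value \<open>\<epsilon>\<close> at \<open>8 * y + k * \<epsilon>\<close> to first order.\<close>
  define k where "k = 4 / (8 * y - 1 / 2)"
  have "cmod (8 * y) < cmod (1 / 2)"
    using assms by (simp add: norm_mult)
  then have "8 * y \<noteq> 1 / 2" by (metis less_irrefl)
  then have d: "8 * y - 1 / 2 \<noteq> 0" by simp
  then have "k \<noteq> 0" by (simp add: k_def)
  have limc: "((\<lambda>\<epsilon>. 8 * y + k * \<epsilon>) \<longlongrightarrow> 8 * y) (at 0)"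
    by (auto intro!: tendsto_eq_intros)
  have small: "(1 + cmod (8 * y)) * (1 + cmod (1 / 2)) * (1 / 4) < 1"
    using assms by (simp add: norm_mult)
  show ?thesis
  proof (rule eventually_disc_through_cubic)
    show "((\<lambda>\<epsilon>. 8 * y) \<longlongrightarrow> 8 * y) (at 0)" "((\<lambda>\<epsilon>. 1 / 2) \<longlongrightarrow> 1 / 2) (at 0)"
      by (rule tendsto_const)+
    show "((\<lambda>\<epsilon>. 8 * y + k * \<epsilon>) \<longlongrightarrow> 8 * y) (at 0)" by fact
    have "\<forall>\<^sub>F \<epsilon> in at 0. 8 * y + k * \<epsilon> \<noteq> 1 / 2"
      by (rule tendsto_imp_eventually_ne[OF limc]) (use d in auto)
    with eventually_neq_at_within
    show "\<forall>\<^sub>F \<epsilon> in at 0. 8 * y \<noteq> 1 / 2 \<and> 8 * y \<noteq> 8 * y + k * \<epsilon> \<and> 1 / 2 \<noteq> 8 * y + k * \<epsilon>"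
      by eventually_elim (use d \<open>k \<noteq> 0\<close> in auto)
    show "((\<lambda>\<epsilon>. \<epsilon> / ((1 / 2 - 8 * y) * (1 / 2 - (8 * y + k * \<epsilon>)))) \<longlongrightarrow> 0 / (8 * y * (8 * y))) (at 0)"
      by (rule tendsto_eq_intros limc refl)+ (use d in auto)
    have "((\<lambda>\<epsilon>. 1 / (k * (8 * y + k * \<epsilon> - 1 / 2))) \<longlongrightarrow> 1 / (k * (8 * y - 1 / 2))) (at 0)"
      by (intro tendsto_intros limc) (use d \<open>k \<noteq> 0\<close> in auto)
    also have "1 / (k * (8 * y - 1 / 2)) = y / (8 * y * (1 / 2))"
      using d assms by (simp add: k_def)
    finally show "((\<lambda>\<epsilon>. \<epsilon> / ((8 * y + k * \<epsilon> - 8 * y) * (8 * y + k * \<epsilon> - 1 / 2)))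
        \<longlongrightarrow> y / (8 * y * (1 / 2))) (at 0)"
      by (rule Lim_transform_eventually)
        (use eventually_neq_at_within[of 0 0 UNIV] in eventually_elim, simp)
    show "(1 + cmod (8 * y)) * (1 + cmod (1 / 2)) * cmod (y / (8 * y * (1 / 2))) < 1"
      using small assms by (simp add: norm_mult norm_divide)
  qed (use assms in \<open>auto simp: norm_mult power2_eq_square\<close>)
qed

text \<open>Here the parameters of \<open>(\<epsilon>, 0)\<close> and \<open>(0, \<epsilon>)\<close> merge at \<open>8 * x\<close>, and the one of the origin is
  \<open>1 / 2\<close>. The limit disc runs in the line \<open>z\<^sub>1 + z\<^sub>2 = 0\<close>, the limit of the line through
  \<open>(\<epsilon>, 0)\<close> and \<open>(0, \<epsilon>)\<close>, so one rate of separation suits both coordinates.\<close>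

lemma upper_bound_antidiagonal:
  assumes "x \<noteq> 0" "cmod x < 1 / 32"
  shows "\<forall>\<^sub>F \<epsilon> in at 0. \<exists>a b c. disc_through \<epsilon> x (- x) a b c \<and>
           cmod (a * b * c) \<le> 1024 * (cmod x)\<^sup>2"
proof -
  define k where "k = - 4 / (8 * x - 1 / 2)"
  have "cmod (8 * x) < cmod (1 / 2)"
    using assms by (simp add: norm_mult)
  then have "8 * x \<noteq> 1 / 2" by (metis less_irrefl)
  then have d: "8 * x - 1 / 2 \<noteq> 0" by simp
  then have "k \<noteq> 0" by (simp add: k_def)
  have kd: "k * (8 * x - 1 / 2) = - 4"
    using k_def by (simp only: nonzero_eq_divide_eq[OF d])
  have limc: "((\<lambda>\<epsilon>. 8 * x + k * \<epsilon>) \<longlongrightarrow> 8 * x) (at 0)"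
    by (auto intro!: tendsto_eq_intros)
  have small: "(1 + cmod (1 / 2)) * (1 + cmod (8 * x)) * (1 / 4) < 1"
    using assms by (simp add: norm_mult)
  show ?thesis
  proof (rule eventually_disc_through_cubic)
    show "((\<lambda>\<epsilon>. 1 / 2) \<longlongrightarrow> 1 / 2) (at 0)" "((\<lambda>\<epsilon>. 8 * x) \<longlongrightarrow> 8 * x) (at 0)"
      by (rule tendsto_const)+
    show "((\<lambda>\<epsilon>. 8 * x + k * \<epsilon>) \<longlongrightarrow> 8 * x) (at 0)" by fact
    have "\<forall>\<^sub>F \<epsilon> in at 0. 8 * x + k * \<epsilon> \<noteq> 1 / 2"
      by (rule tendsto_imp_eventually_ne[OF limc]) (use d in auto)
    with eventually_neq_at_within
    show "\<forall>\<^sub>F \<epsilon> in at 0. 1 / 2 \<noteq> 8 * x \<and> 1 / 2 \<noteq> 8 * x + k * \<epsilon> \<and> 8 * x \<noteq> 8 * x + k * \<epsilon>"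
      by eventually_elim (use d \<open>k \<noteq> 0\<close> in auto)
    have "((\<lambda>\<epsilon>. - 1 / (k * (8 * x - 1 / 2))) \<longlongrightarrow> x / (1 / 2 * (8 * x))) (at 0)"
      unfolding kd using assms by (simp add: tendsto_const)
    then show "((\<lambda>\<epsilon>. \<epsilon> / ((8 * x - 1 / 2) * (8 * x - (8 * x + k * \<epsilon>))))
        \<longlongrightarrow> x / (1 / 2 * (8 * x))) (at 0)"
      by (rule Lim_transform_eventually)
        (use eventually_neq_at_within[of 0 0 UNIV] in eventually_elim, simp add: mult.commute)
    have "((\<lambda>\<epsilon>. 1 / (k * (8 * x + k * \<epsilon> - 1 / 2))) \<longlongrightarrow> 1 / (k * (8 * x - 1 / 2))) (at 0)"
      by (intro tendsto_intros limc) (use d \<open>k \<noteq> 0\<close> in auto)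
    also have "1 / (k * (8 * x - 1 / 2)) = - x / (1 / 2 * (8 * x))"
      unfolding kd using assms by simp
    finally show "((\<lambda>\<epsilon>. \<epsilon> / ((8 * x + k * \<epsilon> - 1 / 2) * (8 * x + k * \<epsilon> - 8 * x)))
        \<longlongrightarrow> - x / (1 / 2 * (8 * x))) (at 0)"
      by (rule Lim_transform_eventually)
        (use eventually_neq_at_within[of 0 0 UNIV] in eventually_elim, simp add: mult.commute)
    show "(1 + cmod (1 / 2)) * (1 + cmod (8 * x)) * cmod (x / (1 / 2 * (8 * x))) < 1"
      "(1 + cmod (1 / 2)) * (1 + cmod (8 * x)) * cmod (- x / (1 / 2 * (8 * x))) < 1"
      using small assms by (simp_all add: norm_mult norm_divide)
  qed (use assms in \<open>auto simp: norm_mult power2_eq_square\<close>)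
qed

text \<open>The parameters are \<open>s\<close>, \<open>s + t * y\<close> and \<open>s - t * x\<close>, all tending to \<open>s\<close>. With the limit disc
  \<open>\<zeta> \<mapsto> (1 - \<zeta> / s)\<^sup>2 z\<close> in mind, offsets \<open>\<beta>\<close> and \<open>\<gamma>\<close> of the last two must satisfy
  \<open>x * \<beta> * (\<beta> - \<gamma>) = \<epsilon> * s\<^sup>2 = y * \<gamma> * (\<gamma> - \<beta>)\<close>. Hence \<open>x * \<beta> = - y * \<gamma>\<close>, that is, \<open>\<beta> = t * y\<close> and
  \<open>\<gamma> = - t * x\<close>, and \<open>t\<close> is determined up to sign by \<open>t\<^sup>2 * x * y * (x + y) = \<epsilon> * s\<^sup>2\<close>. This is where \<open>z\<close>
  has to avoid \<open>z\<^sub>1 = 0\<close>, \<open>z\<^sub>2 = 0\<close> and \<open>z\<^sub>1 + z\<^sub>2 = 0\<close>. The size of \<open>s\<close> makes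
  \<open>\<bar>z\<bar> / \<bar>s\<bar>\<^sup>2 = 1 / 8\<close>, so the limit disc stays well inside the bidisk.\<close>

lemma upper_bound_generic_small:
  assumes ne: "x \<noteq> 0" "y \<noteq> 0" "x + y \<noteq> 0" and r: "r = max (cmod x) (cmod y)" "r < 1 / 32"
  shows "\<forall>\<^sub>F \<epsilon> in at 0. \<exists>a b c. disc_through \<epsilon> x y a b c \<and>
           cmod (a * b * c) \<le> 1024 * r powr (3 / 2)"
proof -
  have "0 < r" using ne r by (auto simp: less_max_iff_disj)
  define s :: complex where "s = of_real (sqrt (8 * r))"
  have s: "cmod s = sqrt (8 * r)" "s \<noteq> 0"
    using \<open>0 < r\<close> by (auto simp: s_def)
  have s2: "cmod s * cmod s = 8 * r"
    using \<open>0 < r\<close> by (simp add: s)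
  have "sqrt (8 * r) \<le> sqrt ((1 / 2)\<^sup>2)"
    using r(2) by (intro real_sqrt_le_mono) (simp add: power2_eq_square)
  then have shalf: "cmod s \<le> 1 / 2"
    by (simp add: s)
  define t where "t = (\<lambda>\<epsilon>. csqrt (\<epsilon> * (s\<^sup>2 / (x * y * (x + y)))))"
  have t2: "t \<epsilon> * t \<epsilon> = \<epsilon> * (s\<^sup>2 / (x * y * (x + y)))" for \<epsilon>
    unfolding t_def by (metis power2_csqrt power2_eq_square)
  have tne: "t \<epsilon> \<noteq> 0" if "\<epsilon> \<noteq> 0" for \<epsilon>
    using that ne s by (simp add: t_def)
  have sqrt0: "((\<lambda>\<epsilon>. sqrt (cmod (\<epsilon> * K))) \<longlongrightarrow> 0) (at 0)" for K :: complex
    by (auto intro!: tendsto_eq_intros)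
  have t0: "(t \<longlongrightarrow> 0) (at 0)"
    using sqrt0[of "s\<^sup>2 / (x * y * (x + y))"]
    unfolding t_def by (subst tendsto_norm_zero_iff[symmetric]) (simp add: norm_csqrt)
  have bound: "(1 + cmod s) * (1 + cmod s) * cmod (u / (s * s)) < 1" if "cmod u \<le> r" for u
  proof -
    have u: "cmod (u / (s * s)) \<le> 1 / 8"
      using that \<open>0 < r\<close> by (simp add: norm_divide norm_mult s2)
    have "(1 + cmod s) * (1 + cmod s) \<le> (3 / 2) * (3 / 2)"
      using shalf by (intro mult_mono) auto
    from mult_mono[OF this u]
    have "(1 + cmod s) * (1 + cmod s) * cmod (u / (s * s)) \<le> (3 / 2) * (3 / 2) * (1 / 8)"
      by simp
    then show ?thesis by simp
  qed
  show ?thesis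
  proof (rule eventually_disc_through_cubic)
    show "((\<lambda>\<epsilon>. s) \<longlongrightarrow> s) (at 0)"
      by (rule tendsto_const)
    show "((\<lambda>\<epsilon>. s + t \<epsilon> * y) \<longlongrightarrow> s) (at 0)" "((\<lambda>\<epsilon>. s - t \<epsilon> * x) \<longlongrightarrow> s) (at 0)"
      by (auto intro!: tendsto_eq_intros t0)
    have sub: "s + t \<epsilon> * y - (s - t \<epsilon> * x) = t \<epsilon> * (x + y)" for \<epsilon>
      by (simp add: algebra_simps)
    have sep: "s + t \<epsilon> * y \<noteq> s - t \<epsilon> * x" if "\<epsilon> \<noteq> 0" for \<epsilon>
      using sub[of \<epsilon>] tne[OF that] ne(3) by auto
    show "\<forall>\<^sub>F \<epsilon> in at 0. s \<noteq> s + t \<epsilon> * y \<and> s \<noteq> s - t \<epsilon> * x \<and> s + t \<epsilon> * y \<noteq> s - t \<epsilon> * x"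
      using eventually_neq_at_within[of 0 0 UNIV] by eventually_elim (use sep tne ne in auto)
    have "\<epsilon> / ((s + t \<epsilon> * y - s) * (s + t \<epsilon> * y - (s - t \<epsilon> * x))) = x / (s * s)" if "\<epsilon> \<noteq> 0" for \<epsilon>
    proof -
      have "(s + t \<epsilon> * y - s) * (s + t \<epsilon> * y - (s - t \<epsilon> * x)) = (t \<epsilon> * t \<epsilon>) * (y * (x + y))"
        unfolding sub by simp
      then show ?thesis
        unfolding t2 using ne that s by (simp add: power2_eq_square)
    qed
    then show "((\<lambda>\<epsilon>. \<epsilon> / ((s + t \<epsilon> * y - s) * (s + t \<epsilon> * y - (s - t \<epsilon> * x)))) \<longlongrightarrow> x / (s * s)) (at 0)"
      by (intro tendsto_eventually) (use eventually_neq_at_within[of 0 0 UNIV] in eventually_elim, auto)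
    have "\<epsilon> / ((s - t \<epsilon> * x - s) * (s - t \<epsilon> * x - (s + t \<epsilon> * y))) = y / (s * s)" if "\<epsilon> \<noteq> 0" for \<epsilon>
    proof -
      have "(s - t \<epsilon> * x - s) * (s - t \<epsilon> * x - (s + t \<epsilon> * y)) = (t \<epsilon> * t \<epsilon>) * (x * (x + y))"
        by (simp add: algebra_simps)
      then show ?thesis
        unfolding t2 using ne that s by (simp add: power2_eq_square)
    qed
    then show "((\<lambda>\<epsilon>. \<epsilon> / ((s - t \<epsilon> * x - s) * (s - t \<epsilon> * x - (s + t \<epsilon> * y)))) \<longlongrightarrow> y / (s * s)) (at 0)"
      by (intro tendsto_eventually) (use eventually_neq_at_within[of 0 0 UNIV] in eventually_elim, auto)
    show "(1 + cmod s) * (1 + cmod s) * cmod (x / (s * s)) < 1"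
      "(1 + cmod s) * (1 + cmod s) * cmod (y / (s * s)) < 1"
      using r by (auto intro: bound)
    have "r powr (3 / 2) = r * sqrt r"
      using \<open>0 < r\<close> powr_add[of r 1 "1 / 2"] by (simp add: powr_half_sqrt)
    moreover have "sqrt 8 < (128 :: real)"
      by (rule real_less_lsqrt) auto
    ultimately show "cmod (s * s * s) < 1024 * r powr (3 / 2)"
      using \<open>0 < r\<close> s2 by (simp add: norm_mult s real_sqrt_mult)
    show "cmod s < 1" "cmod s < 1" "cmod s < 1"
      using shalf by linarith+
  qed (simp_all add: s(2))
qed

text \<open>A multiple \<open>u\<close> of the Blaschke product with zeros \<open>p\<close>, \<open>q\<close>, \<open>w\<close> takes the value \<open>x\<close> at \<open>0\<close>, with
  \<open>cmod u < 1\<close>. Adding a small multiple of the function \<open>\<zeta>\<close> times the Blaschke factors of \<open>p\<close> and \<open>q\<close>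
  corrects the value at \<open>w\<close> and nothing else.\<close>

lemma eventually_Blaschke_interpolation:
  assumes "cmod p < 1" "cmod q < 1" "cmod w < 1"
    and ne: "p \<noteq> 0" "q \<noteq> 0" "w \<noteq> 0" "w \<noteq> p" "w \<noteq> q" and x: "cmod x < cmod (p * q * w)"
  shows "\<forall>\<^sub>F \<epsilon> in at 0. \<exists>f. f holomorphic_on ball 0 1 \<and> (\<forall>\<zeta>. cmod \<zeta> < 1 \<longrightarrow> cmod (f \<zeta>) < 1) \<and>
           f 0 = x \<and> f p = 0 \<and> f q = 0 \<and> f w = \<epsilon>"
proof -
  let ?B = "Moebius_function 0"
  have Bw: "?B v w \<noteq> 0" if "cmod v < 1" "w \<noteq> v" for v
  proof -
    have "?B (- v) (?B v w) = w"
      using that assms by (intro Moebius_function_compose) auto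
    then show ?thesis
      using that by (auto simp: Moebius_function_of_zero)
  qed
  define u where "u = - x / (p * q * w)"
  define v where "v = (\<lambda>\<epsilon>. \<epsilon> / (?B p w * ?B q w * w))"
  have u: "cmod u < 1"
    using x ne by (simp add: u_def norm_divide)
  have "((\<lambda>\<epsilon>. cmod u + cmod (v \<epsilon>)) \<longlongrightarrow> cmod u + cmod (v 0)) (at 0)"
    unfolding v_def by (intro tendsto_intros) (use Bw ne assms in auto)
  then have "\<forall>\<^sub>F \<epsilon> in at 0. cmod u + cmod (v \<epsilon>) < 1"
    by (rule order_tendstoD) (use u in \<open>simp add: v_def\<close>)
  then show ?thesis
  proof eventually_elim
    case (elim \<epsilon>)
    let ?f = "\<lambda>\<zeta>. ?B p \<zeta> * ?B q \<zeta> * (u * ?B w \<zeta> + v \<epsilon> * \<zeta>)"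
    have "cmod (?f \<zeta>) < 1" if "cmod \<zeta> < 1" for \<zeta>
    proof -
      have B: "cmod (?B p \<zeta>) \<le> 1" "cmod (?B q \<zeta>) \<le> 1" "cmod (?B w \<zeta>) \<le> 1"
        using assms that by (auto intro!: less_imp_le Moebius_function_norm_lt_1)
      have "cmod (u * ?B w \<zeta> + v \<epsilon> * \<zeta>) \<le> cmod u + cmod (v \<epsilon>)"
        using norm_affine_le[of \<zeta> "u * ?B w \<zeta>" "v \<epsilon>"] mult_left_mono[OF B(3), of "cmod u"] that
        by (simp add: norm_mult)
      then have "cmod (?f \<zeta>) \<le> 1 * 1 * (cmod u + cmod (v \<epsilon>))"
        unfolding norm_mult by (intro mult_mono B) auto
      then show ?thesis using elim by simp
    qed
    moreover have "?f holomorphic_on ball 0 1"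
      by (intro holomorphic_intros Moebius_function_holomorphic assms)
    moreover have "?f 0 = x"
      using ne by (simp add: Moebius_function_of_zero u_def)
    moreover have "?f p = 0" "?f q = 0"
      by (simp_all add: Moebius_function_eq_zero)
    moreover have "?f w = \<epsilon>"
      using Bw assms by (simp add: Moebius_function_eq_zero v_def)
    ultimately show ?case by blast
  qed
qed

text \<open>Any three distinct parameters close enough to the unit circle will do; the modulus \<open>\<rho>\<close> is
  chosen so that \<open>\<rho> ^ 3\<close> exceeds the moduli of \<open>x\<close> and \<open>y\<close>.\<close>

lemma eventually_disc_through:
  assumes "cmod x < 1" "cmod y < 1"
  shows "\<forall>\<^sub>F \<epsilon> in at 0. \<exists>a b c. disc_through \<epsilon> x y a b c \<and> cmod (a * b * c) \<le> 1"
proof -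
  define m where "m = max (cmod x) (cmod y)"
  have m: "0 \<le> m" "m < 1"
    using assms by (auto simp: m_def le_max_iff_disj)
  define \<rho> where "\<rho> = 1 - (1 - m) / 4"
  have \<rho>: "0 < \<rho>" "\<rho> < 1"
    using m by (auto simp: \<rho>_def)
  have "m < 1 + real 3 * (\<rho> - 1)"
    using m by (simp add: \<rho>_def field_simps)
  also have "\<dots> \<le> (1 + (\<rho> - 1)) ^ 3"
    using \<rho> by (intro Bernoulli_inequality) auto
  finally have "m < \<rho> ^ 3"
    by simp
  define a b c :: complex where "a = of_real \<rho>" "b = - of_real \<rho>" "c = \<i> * of_real \<rho>"
  have norms: "cmod a = \<rho>" "cmod b = \<rho>" "cmod c = \<rho>"
    using \<rho> by (simp_all add: a_b_c_def norm_mult)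
  have lt: "cmod a < 1" "cmod b < 1" "cmod c < 1"
    using \<rho> norms by auto
  have ne: "a \<noteq> 0" "b \<noteq> 0" "c \<noteq> 0" "a \<noteq> b" "a \<noteq> c" "b \<noteq> c"
    using \<rho> by (auto simp: a_b_c_def complex_eq_iff)
  have prod: "cmod x < cmod (a * c * b)" "cmod y < cmod (a * b * c)"
    using \<open>m < \<rho> ^ 3\<close> by (auto simp: norm_mult norms m_def power3_eq_cube mult_ac)
  have "\<forall>\<^sub>F \<epsilon> in at 0. \<exists>f. f holomorphic_on ball 0 1 \<and> (\<forall>\<zeta>. cmod \<zeta> < 1 \<longrightarrow> cmod (f \<zeta>) < 1) \<and>
           f 0 = x \<and> f a = 0 \<and> f c = 0 \<and> f b = \<epsilon>"
    using lt ne prod by (intro eventually_Blaschke_interpolation) auto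
  moreover have "\<forall>\<^sub>F \<epsilon> in at 0. \<exists>g. g holomorphic_on ball 0 1 \<and> (\<forall>\<zeta>. cmod \<zeta> < 1 \<longrightarrow> cmod (g \<zeta>) < 1) \<and>
           g 0 = y \<and> g a = 0 \<and> g b = 0 \<and> g c = \<epsilon>"
    using lt ne prod by (intro eventually_Blaschke_interpolation) auto
  ultimately show ?thesis
  proof eventually_elim
    case (elim \<epsilon>)
    then have "disc_through \<epsilon> x y a b c"
      using lt unfolding disc_through_def by blast
    moreover have "cmod (a * b * c) \<le> 1"
      using \<rho> by (simp add: norm_mult norms mult_le_one)
    ultimately show ?case by blast
  qed
qed

text \<open>At \<open>z = 0\<close> the bound to be reached is \<open>- \<infinity>\<close>, so the parameter of the pole \<open>(0, 0)\<close> must be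
  \<open>0\<close>.\<close>

lemma eventually_disc_through_origin:
  "\<forall>\<^sub>F \<epsilon> in at 0. disc_through \<epsilon> 0 0 0 (1 / 2) (- 1 / 2)"
proof -
  have "\<forall>\<^sub>F \<epsilon> :: complex in at 0. cmod \<epsilon> < 1 / 3"
    by (rule order_tendstoD[OF tendsto_norm_zero[OF tendsto_ident_at]]) simp
  then show ?thesis
  proof eventually_elim
    case (elim \<epsilon>)
    have bd: "cmod (2 * \<epsilon> * \<zeta> * (\<zeta> + h)) < 1" if "cmod \<zeta> < 1" "cmod h = 1 / 2" for \<zeta> h
    proof -
      have "cmod (\<zeta> + h) \<le> 3 / 2"
        using that norm_triangle_ineq[of \<zeta> h] by linarith
      then have "cmod (2 * \<epsilon> * \<zeta> * (\<zeta> + h)) \<le> 2 * cmod \<epsilon> * 1 * (3 / 2)"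
        unfolding norm_mult using that by (intro mult_mono) auto
      then show ?thesis using elim by simp
    qed
    show ?case
      by (rule disc_throughI[where f = "\<lambda>\<zeta>. 2 * \<epsilon> * \<zeta> * (\<zeta> + 1 / 2)"
            and g = "\<lambda>\<zeta>. 2 * \<epsilon> * \<zeta> * (\<zeta> + - 1 / 2)"])
        (auto intro!: holomorphic_intros bd bd[where h = "- 1 / 2", simplified])
  qed
qed

text \<open>The constant \<open>1024\<close> is \<open>32\<^sup>2\<close>, so that the right-hand side is at least \<open>1\<close> once \<open>r \<ge> 1 / 32\<close>.\<close>

lemma upper_bound_special:
  assumes "cmod x < 1" "cmod y < 1" "x = 0 \<or> y = 0 \<or> x + y = 0"
    and r: "r = max (cmod x) (cmod y)"
  shows "\<forall>\<^sub>F \<epsilon> in at 0. \<exists>a b c. disc_through \<epsilon> x y a b c \<and>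
           cmod (a * b * c) \<le> 1024 * r powr 2"
proof -
  have "0 \<le> r" using r by (simp add: le_max_iff_disj)
  consider "r = 0" | "1 / 32 \<le> r" | "0 < r" "r < 1 / 32"
    using \<open>0 \<le> r\<close> by linarith
  then show ?thesis
  proof cases
    case 1
    then have "x = 0" "y = 0"
      using r by (metis max.cobounded1 max.cobounded2 norm_le_zero_iff)+
    then show ?thesis
      using eventually_disc_through_origin \<open>0 \<le> r\<close>
      by (auto elim!: eventually_mono intro!: exI[of _ 0] exI)
  next
    case 2
    then have "(1 / 32)\<^sup>2 \<le> r\<^sup>2"
      by (intro power_mono) auto
    then have "1 \<le> 1024 * r powr 2"
      using \<open>0 \<le> r\<close> by (simp add: power2_eq_square)
    then show ?thesis
      using eventually_disc_through[OF assms(1,2)]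
      by (auto elim!: eventually_mono intro: order_trans)
  next
    case 3
    have r2: "r powr 2 = r\<^sup>2" using \<open>0 \<le> r\<close> by simp
    consider "x = 0" | "y = 0" | "y = - x"
      using assms(3) by (auto simp: eq_neg_iff_add_eq_0 add.commute)
    then show ?thesis
    proof cases
      case 1
      then show ?thesis
        using upper_bound_axis[of y] 3 r unfolding r2 by auto
    next
      case 2
      have "\<forall>\<^sub>F \<epsilon> in at 0. \<exists>a b c. disc_through \<epsilon> 0 x a b c \<and> cmod (a * b * c) \<le> 1024 * (cmod x)\<^sup>2"
        using upper_bound_axis[of x] 2 3 r by auto
      then show ?thesis
        unfolding r2
      proof eventually_elim
        case (elim \<epsilon>)
        then obtain a b c where "disc_through \<epsilon> 0 x a b c" "cmod (a * b * c) \<le> 1024 * (cmod x)\<^sup>2"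
          by blast
        then show ?case
          using disc_through_swap 2 r
          by (intro exI[of _ a] exI[of _ c] exI[of _ b]) (auto simp: mult_ac)
      qed
    next
      case 3
      then show ?thesis
        using upper_bound_antidiagonal[of x] \<open>0 < r\<close> \<open>r < 1 / 32\<close> r unfolding r2 by auto
    qed
  qed
qed

lemma upper_bound_generic:
  assumes "cmod x < 1" "cmod y < 1" "x \<noteq> 0" "y \<noteq> 0" "x + y \<noteq> 0"
    and r: "r = max (cmod x) (cmod y)"
  shows "\<forall>\<^sub>F \<epsilon> in at 0. \<exists>a b c. disc_through \<epsilon> x y a b c \<and>
           cmod (a * b * c) \<le> 1024 * r powr (3 / 2)"
proof (cases "r < 1 / 32")
  case True
  then show ?thesis using upper_bound_generic_small assms by blast
next
  case False
  then have "(1 / 32) powr 2 \<le> r powr 2"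
    by (intro powr_mono2) auto
  also have "\<dots> \<le> r powr (3 / 2)"
    using assms False by (intro powr_mono') auto
  finally have "1 \<le> 1024 * r powr (3 / 2)"
    by (simp add: power2_eq_square)
  then show ?thesis
    using eventually_disc_through[OF assms(1,2)]
    by (auto elim!: eventually_mono intro: order_trans)
qed

section \<open>The limits\<close>

lemma at_0_within_unit_disc: "at 0 within unit_disc - {0} = at 0"
proof -
  have "at 0 within unit_disc - {0} = at 0 within unit_disc"
    by (simp add: at_within_def)
  then show ?thesis
    by (simp add: unit_disc_def at_within_ball)
qed

lemma Limsup_lempert_eps_le:
  assumes "\<forall>\<^sub>F \<epsilon> in at 0. \<exists>a b c. disc_through \<epsilon> (z $ 1) (z $ 2) a b c \<and> cmod (a * b * c) \<le> m"
  shows "Limsup (at 0 within unit_disc - {0}) (\<lambda>\<epsilon>. lempert_eps \<epsilon> z) \<le> elog m"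
  unfolding at_0_within_unit_disc
  by (rule Limsup_bounded) (use assms in \<open>auto elim!: eventually_mono intro: lempert_eps_le\<close>)

lemma Liminf_lempert_eps_ge:
  assumes "0 \<le> m" and "\<forall>\<^sub>F \<epsilon> in at 0. \<forall>a b c. disc_through \<epsilon> (z $ 1) (z $ 2) a b c \<longrightarrow> m \<le> cmod (a * b * c)"
  shows "elog m \<le> Liminf (at 0 within unit_disc - {0}) (\<lambda>\<epsilon>. lempert_eps \<epsilon> z)"
  unfolding at_0_within_unit_disc
  by (rule Liminf_bounded) (use assms in \<open>auto elim!: eventually_mono intro: lempert_eps_ge\<close>)

theorem theorem1p1:
  shows "(\<exists>C>0. \<forall>z\<in>bidisk. z $ 1 = 0 \<or> z $ 2 = 0 \<or> z $ 1 + z $ 2 = 0 \<longrightarrow>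
            Limsup (at 0 within unit_disc - {0}) (\<lambda>\<epsilon>. lempert_eps \<epsilon> z)
              \<le> ereal 2 * elog (max_norm z) + ereal C)
       \<and> (\<forall>c\<^sub>0>0. \<exists>C>0. \<forall>z\<in>bidisk.
            z $ 1 \<noteq> 0 \<and> z $ 2 \<noteq> 0 \<and>
            c\<^sub>0 \<le> cmod (z $ 1 / z $ 2) \<and> cmod (z $ 1 / z $ 2) \<le> inverse c\<^sub>0 \<and>
            c\<^sub>0 \<le> cmod (1 + z $ 1 / z $ 2) \<longrightarrow>
              Liminf (at 0 within unit_disc - {0}) (\<lambda>\<epsilon>. lempert_eps \<epsilon> z)
                \<ge> ereal (3 / 2) * elog (max_norm z) - ereal C \<and>
              Liminf (at 0 within unit_disc - {0}) (\<lambda>\<epsilon>. lempert_eps \<epsilon> z)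
                \<le> ereal (3 / 2) * elog (max_norm z) + ereal C)"
proof (intro conjI allI impI)
  have nonneg: "0 \<le> max_norm z" for z
    by (simp add: max_norm_def le_max_iff_disj)
  have bidisk: "cmod (z $ 1) < 1" "cmod (z $ 2) < 1" if "z \<in> bidisk" for z
    using that by (auto simp: bidisk_def unit_disc_def)
  show "\<exists>C>0. \<forall>z\<in>bidisk. z $ 1 = 0 \<or> z $ 2 = 0 \<or> z $ 1 + z $ 2 = 0 \<longrightarrow>
            Limsup (at 0 within unit_disc - {0}) (\<lambda>\<epsilon>. lempert_eps \<epsilon> z)
              \<le> ereal 2 * elog (max_norm z) + ereal C"
  proof (intro exI[of _ "ln 1024"] conjI ballI impI)
    fix z :: "complex ^ 2"
    assume "z \<in> bidisk" and z: "z $ 1 = 0 \<or> z $ 2 = 0 \<or> z $ 1 + z $ 2 = 0"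
    have "Limsup (at 0 within unit_disc - {0}) (\<lambda>\<epsilon>. lempert_eps \<epsilon> z)
        \<le> elog (1024 * max_norm z powr 2)"
      by (rule Limsup_lempert_eps_le, rule upper_bound_special[OF bidisk z])
        (use \<open>z \<in> bidisk\<close> in \<open>auto simp: max_norm_def\<close>)
    then show "Limsup (at 0 within unit_disc - {0}) (\<lambda>\<epsilon>. lempert_eps \<epsilon> z)
        \<le> ereal 2 * elog (max_norm z) + ereal (ln 1024)"
      using nonneg[of z] by (subst elog_powr) auto
  qed simp
  fix c\<^sub>0 :: real
  assume "0 < c\<^sub>0"
  define C where "C = max (ln 1024) (- ln (c\<^sub>0\<^sup>2 / 3))"
  have expC: "1024 \<le> exp C" "exp (- C) \<le> c\<^sub>0\<^sup>2 / 3"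
  proof -
    have "exp (ln 1024) \<le> exp C" unfolding C_def exp_le_cancel_iff by simp
    then show "1024 \<le> exp C" by simp
    have "exp (- C) \<le> exp (ln (c\<^sub>0\<^sup>2 / 3))" unfolding C_def exp_le_cancel_iff by simp
    then show "exp (- C) \<le> c\<^sub>0\<^sup>2 / 3" using \<open>0 < c\<^sub>0\<close> by simp
  qed
  have bounds: "ereal (3 / 2) * elog (max_norm z) - ereal C
           \<le> Liminf (at 0 within unit_disc - {0}) (\<lambda>\<epsilon>. lempert_eps \<epsilon> z) \<and>
         Liminf (at 0 within unit_disc - {0}) (\<lambda>\<epsilon>. lempert_eps \<epsilon> z)
           \<le> ereal (3 / 2) * elog (max_norm z) + ereal C"
    if "z \<in> bidisk" and z: "z $ 1 \<noteq> 0 \<and> z $ 2 \<noteq> 0 \<and>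
            c\<^sub>0 \<le> cmod (z $ 1 / z $ 2) \<and> cmod (z $ 1 / z $ 2) \<le> inverse c\<^sub>0 \<and>
            c\<^sub>0 \<le> cmod (1 + z $ 1 / z $ 2)" for z
  proof
    define r where "r = max_norm z"
    have r: "r = max (cmod (z $ 1)) (cmod (z $ 2))"
      by (simp add: r_def max_norm_def)
    have "0 < r" using z r by (auto simp: less_max_iff_disj)
    have "c\<^sub>0 \<le> inverse c\<^sub>0" using z by linarith
    then have "c\<^sub>0 * c\<^sub>0 \<le> 1"
      using \<open>0 < c\<^sub>0\<close> by (simp add: field_simps)
    then have "c\<^sub>0 \<le> 1"
      using \<open>0 < c\<^sub>0\<close> by (metis less_eq_real_def mult_le_cancel_left1 not_le order_trans)
    have "c\<^sub>0 * cmod (z $ 2) \<le> cmod (z $ 1)" "c\<^sub>0 * cmod (z $ 1) \<le> cmod (z $ 2)"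
      using z \<open>0 < c\<^sub>0\<close> by (auto simp: norm_divide field_simps)
    moreover have "c\<^sub>0 * cmod (z $ 1) \<le> cmod (z $ 1)" "c\<^sub>0 * cmod (z $ 2) \<le> cmod (z $ 2)"
      using \<open>c\<^sub>0 \<le> 1\<close> by (simp_all add: mult_left_le_one_le \<open>0 < c\<^sub>0\<close> less_imp_le)
    ultimately have z12: "c\<^sub>0 * r \<le> cmod (z $ 1)" "c\<^sub>0 * r \<le> cmod (z $ 2)"
      by (auto simp: r max_def)
    have "c\<^sub>0\<^sup>2 * r \<le> c\<^sub>0 * cmod (z $ 2)"
      using z12(2) \<open>0 < c\<^sub>0\<close> by (simp add: power2_eq_square)
    also have "\<dots> \<le> cmod (1 + z $ 1 / z $ 2) * cmod (z $ 2)"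
      using z by (intro mult_right_mono) auto
    also have "\<dots> = cmod (z $ 1 + z $ 2)"
      using z by (simp flip: norm_mult add: distrib_right add.commute)
    finally have sum: "c\<^sub>0\<^sup>2 * r \<le> cmod (z $ 1 + z $ 2)" .
    have "\<forall>\<^sub>F \<epsilon> in at 0. cmod \<epsilon> < min 1 (c\<^sub>0\<^sup>2 * r / 2)"
      using \<open>0 < c\<^sub>0\<close> \<open>0 < r\<close>
      by (intro order_tendstoD(2)[OF tendsto_norm_zero[OF tendsto_ident_at]]) simp
    then have "\<forall>\<^sub>F \<epsilon> in at 0. \<forall>a b c. disc_through \<epsilon> (z $ 1) (z $ 2) a b c \<longrightarrow>
        c\<^sub>0\<^sup>2 / 3 * r powr (3 / 2) \<le> cmod (a * b * c)"
      using eventually_neq_at_within[of 0 0 UNIV]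
    proof eventually_elim
      case (elim \<epsilon>)
      then show ?case
        using z12 sum \<open>0 < c\<^sub>0\<close> \<open>0 < r\<close>
        by (intro allI impI disc_through_product_ge[of \<epsilon> "z $ 1" "z $ 2"]) auto
    qed
    then have "elog (c\<^sub>0\<^sup>2 / 3 * r powr (3 / 2))
        \<le> Liminf (at 0 within unit_disc - {0}) (\<lambda>\<epsilon>. lempert_eps \<epsilon> z)"
      using \<open>0 < r\<close> by (intro Liminf_lempert_eps_ge) auto
    moreover have "ereal (3 / 2) * elog r - ereal C \<le> elog (c\<^sub>0\<^sup>2 / 3 * r powr (3 / 2))"
    proof -
      have "ereal (3 / 2) * elog r - ereal C = ereal (3 / 2) * elog r + ereal (- C)"
        by (simp add: minus_ereal_def)
      also have "\<dots> = elog (exp (- C) * r powr (3 / 2))"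
        using \<open>0 < r\<close> by (intro elog_powr) auto
      also have "\<dots> \<le> elog (c\<^sub>0\<^sup>2 / 3 * r powr (3 / 2))"
        using expC by (intro elog_mono mult_right_mono) auto
      finally show ?thesis .
    qed
    ultimately show "ereal (3 / 2) * elog (max_norm z) - ereal C
        \<le> Liminf (at 0 within unit_disc - {0}) (\<lambda>\<epsilon>. lempert_eps \<epsilon> z)"
      unfolding r_def by (rule order_trans[rotated])
    have "z $ 1 + z $ 2 \<noteq> 0"
    proof -
      have "0 < c\<^sub>0\<^sup>2 * r"
        using \<open>0 < c\<^sub>0\<close> \<open>0 < r\<close> by simp
      then have "0 < cmod (z $ 1 + z $ 2)"
        using sum by (rule less_le_trans)
      then show ?thesis
        by (simp only: zero_less_norm_iff not_False_eq_True)
    qed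
    have "Liminf (at 0 within unit_disc - {0}) (\<lambda>\<epsilon>. lempert_eps \<epsilon> z)
        \<le> Limsup (at 0 within unit_disc - {0}) (\<lambda>\<epsilon>. lempert_eps \<epsilon> z)"
      by (rule Liminf_le_Limsup) (simp add: at_0_within_unit_disc)
    also have "\<dots> \<le> elog (1024 * r powr (3 / 2))"
      using bidisk[OF \<open>z \<in> bidisk\<close>] z \<open>z $ 1 + z $ 2 \<noteq> 0\<close> r
      by (intro Limsup_lempert_eps_le upper_bound_generic) auto
    also have "\<dots> \<le> elog (exp C * r powr (3 / 2))"
      using expC by (intro elog_mono mult_right_mono) auto
    also have "\<dots> = ereal (3 / 2) * elog (max_norm z) + ereal C"
      using \<open>0 < r\<close> unfolding r_def by (intro elog_powr[symmetric]) auto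
    finally show "Liminf (at 0 within unit_disc - {0}) (\<lambda>\<epsilon>. lempert_eps \<epsilon> z)
        \<le> ereal (3 / 2) * elog (max_norm z) + ereal C" .
  qed
  have "0 < C" by (simp add: C_def less_max_iff_disj)
  with bounds show "\<exists>C>0. \<forall>z\<in>bidisk. z $ 1 \<noteq> 0 \<and> z $ 2 \<noteq> 0 \<and>
            c\<^sub>0 \<le> cmod (z $ 1 / z $ 2) \<and> cmod (z $ 1 / z $ 2) \<le> inverse c\<^sub>0 \<and>
            c\<^sub>0 \<le> cmod (1 + z $ 1 / z $ 2) \<longrightarrow>
              ereal (3 / 2) * elog (max_norm z) - ereal C
                \<le> Liminf (at 0 within unit_disc - {0}) (\<lambda>\<epsilon>. lempert_eps \<epsilon> z) \<and>
              Liminf (at 0 within unit_disc - {0}) (\<lambda>\<epsilon>. lempert_eps \<epsilon> z)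
                \<le> ereal (3 / 2) * elog (max_norm z) + ereal C"
    by blast
qed

end
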